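(* Let $\ell\geq 2$ be an integer. Then for every integer $n\geq 0$, $\overline{R_\ell^\ast}(n)$ is odd if and only if $\frac{24n}{\ell}+1$ is the square of an integer.
   Context: An overpartition of $n$ is a partition of $n$ in which the first occurrence of each part size may optionally be overlined. For a positive integer $\ell$, $\overline{R_\ell^\ast}(n)$ denotes the number of overpartitions of $n$ in which no non-overlined part is divisible by $\ell$. Equivalently, with $f_k:=\prod_{i\geq 1}(1-q^{ki})$, one has $\sum_{n\geq 0}\overline{R_\ell^\ast}(n)q^n = \frac{f_2 f_\ell}{f_1^2}$.
   Formalization: The criterion is corrected to "ℓ divides n and 24n/ℓ + 1 is the square of an integer"; without divisibility the claim fails, e.g. ℓ = 3, n = 1, where the count is 2 (even) but 24/3 + 1 = 9 = 3². *)

theory Defs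
  imports Complex_Main "HOL-Library.Multiset"
begin

text \<open>
  An overpartition of \<open>n\<close> is encoded as a pair \<open>(M, S)\<close>: \<open>M\<close> is the multiset of all parts
  (overlined or not), and \<open>S\<close> is the set of those part sizes whose first occurrence is overlined.
  Since at most one occurrence of each size is overlined, a set suffices.
\<close>

definition overpartitions :: "nat \<Rightarrow> (nat multiset \<times> nat set) set" where
  "overpartitions n = {(M, S). 0 \<notin># M \<and> sum_mset M = n \<and> S \<subseteq> set_mset M}"

definition nonoverlined_parts :: "nat multiset \<times> nat set \<Rightarrow> nat multiset" where
  "nonoverlined_parts P = fst P - mset_set (snd P)"

definition Rbar_star :: "nat \<Rightarrow> nat \<Rightarrow> nat" where
  "Rbar_star l n = card {P \<in> overpartitions n. \<forall>p \<in># nonoverlined_parts P. \<not> l dvd p}"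

lemma size_le_sum_mset:
  assumes "0 \<notin># (M :: nat multiset)"
  shows "size M \<le> sum_mset M"
  using assms by (induction M) auto

lemma finite_overpartitions: "finite (overpartitions n)"
proof -
  let ?L = "{xs. set xs \<subseteq> {..n} \<and> length xs \<le> n}"
  have "overpartitions n \<subseteq> (mset ` ?L) \<times> Pow {..n}"
  proof
    fix P assume "P \<in> overpartitions n"
    then obtain M S where P: "P = (M, S)" "0 \<notin># M" "sum_mset M = n" "S \<subseteq> set_mset M"
      by (auto simp: overpartitions_def)
    obtain xs where xs: "mset xs = M"
      using ex_mset by blast
    have M: "set_mset M \<subseteq> {..n}"
    proof
      fix p assume "p \<in># M"
      then obtain N where "M = add_mset p N"
        by (metis mset_add)
      then show "p \<in> {..n}" using P(3) by auto
    qed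
    have "set xs \<subseteq> {..n}"
      using M xs by auto
    moreover have "length xs \<le> n"
      using size_le_sum_mset[OF P(2)] P(3) xs by auto
    ultimately show "P \<in> (mset ` ?L) \<times> Pow {..n}"
      using P M xs by blast
  qed
  moreover have "finite ((mset ` ?L) \<times> Pow {..n})"
    by (simp add: finite_lists_length_le)
  ultimately show ?thesis
    by (rule finite_subset)
qed

text \<open>
  Pitfall: the parity criterion ``\<open>24 n / l + 1\<close> is the square of an integer'' is only correct when
  \<open>n / l\<close> is an integer. For instance \<open>Rbar_star 3 1 = 2\<close> is even although \<open>24 / 3 + 1 = 3 ^ 2\<close>. The
  theorem therefore states \<open>l dvd n\<close> as an explicit part of the criterion.
\<close>

end

theory Submission
  imports Defs "HOL-Library.Disjoint_Sets" "HOL-Library.Nat_Bijection"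
    "HOL-Computational_Algebra.Polynomial"
begin

text \<open>
  The overlined status of the smallest part not divisible by \<open>l\<close> can be toggled freely. This
  involution has as fixed points the overpartitions all of whose parts are divisible by \<open>l\<close>; in
  these every part is overlined, so they are the partitions of \<open>n / l\<close> into distinct parts,
  scaled by \<open>l\<close>. By Euler's pentagonal number theorem modulo 2, the number of those is odd iff
  \<open>n / l\<close> has the form \<open>k (3 k + 1) / 2\<close> with \<open>k\<close> an integer. The pentagonal number theorem is
  extracted from Shanks' finite version, which is proved by telescoping.
\<close>

section \<open>Euler's pentagonal number theorem\<close>

text \<open>The generalized pentagonal numbers: \<open>k \<ge> 0\<close> gives 0, 2, 7, 15, ... and
  \<open>k < 0\<close> gives 1, 5, 12, .... The value is never negative, so \<open>nat\<close> loses
  nothing.\<close>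

definition pent :: "int \<Rightarrow> nat" where
  "pent k = nat (k * (3 * k + 1) div 2)"

lemma two_pent: "2 * int (pent k) = k * (3 * k + 1)"
proof -
  have "even (k * (3 * k + 1))"
    by simp
  moreover have "k * (3 * k + 1) \<ge> 0"
    by (cases "k \<ge> 0") (auto intro: mult_nonpos_nonpos)
  ultimately show ?thesis
    by (simp add: pent_def)
qed

lemma pent_square: "24 * int (pent k) + 1 = (6 * k + 1)\<^sup>2"
  using two_pent[of k] by (simp add: power2_eq_square algebra_simps)

lemma inj_pent: "inj pent"
proof (rule injI)
  fix j k assume "pent j = pent k"
  then have "(6 * j + 1)\<^sup>2 = (6 * k + 1)\<^sup>2"
    by (simp flip: pent_square)
  then show "j = k"
    \<comment> \<open>The other sign, \<open>6 * j + 1 = - (6 * k + 1)\<close>, fails modulo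
      6.\<close>
    unfolding power2_eq_iff by presburger
qed

text \<open>Confines the solutions of \<open>pent k = m\<close> to the window from \<open>-m\<close>
  to \<open>m\<close>, which is the range of summation in Shanks' identity.\<close>

lemma abs_le_pent: "\<bar>k\<bar> \<le> int (pent k)"
proof -
  have "2 * \<bar>k\<bar> \<le> k * (3 * k + 1)"
  proof (cases "k \<ge> 1")
    case True
    then have "k * 2 \<le> k * (3 * k + 1)"
      by (intro mult_left_mono) auto
    with True show ?thesis by simp
  next
    case False
    then have "(- k) * 2 \<le> (- k) * (- 3 * k - 1)"
      by (cases "k = 0") (auto intro!: mult_left_mono simp del: mult_minus_left)
    with False show ?thesis by (simp add: algebra_simps)
  qed
  then show ?thesis
    using two_pent[of k] by linarith
qed

text \<open>Completing the square gives one direction. Conversely, a root \<open>x\<close> is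
  coprime to 6, so \<open>x\<close> or \<open>-x\<close> is 1 modulo 6.\<close>

lemma ex_pent_iff_square: "(\<exists>k. pent k = m) \<longleftrightarrow> (\<exists>x::int. 24 * int m + 1 = x\<^sup>2)"
proof
  assume "\<exists>x::int. 24 * int m + 1 = x\<^sup>2"
  then obtain x :: int where x: "24 * int m + 1 = x\<^sup>2" by blast
  have "odd (x\<^sup>2)" "\<not> 3 dvd x\<^sup>2"
    unfolding x[symmetric] by presburger+
  then have "odd x" "\<not> 3 dvd x"
    by (auto simp: power2_eq_square)
  then have "x mod 6 = 1 \<or> (- x) mod 6 = 1"
    by presburger
  then obtain k where "x = 6 * k + 1 \<or> - x = 6 * k + 1"
    by (metis mult_div_mod_eq)
  then have "x\<^sup>2 = (6 * k + 1)\<^sup>2"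
    by (metis power2_minus)
  then have "pent k = m"
    using x pent_square[of k] by simp
  then show "\<exists>k. pent k = m" ..
qed (use pent_square in blast)

section \<open>Shanks' finite form of the pentagonal number theorem\<close>

lemma pent_int_Suc: "pent (int (Suc n)) = Suc n * Suc n + triangle (Suc n)"
proof -
  have "2 * triangle (Suc n) = Suc n * Suc (Suc n)"
    by (simp add: triangle_def)
  then have "2 * int (triangle (Suc n)) = (int n + 1) * (int n + 2)"
    by (metis (no_types, lifting) of_nat_mult of_nat_Suc of_nat_numeral add.commute add.assoc one_add_one)
  then show ?thesis
    using two_pent[of "int (Suc n)"] by (simp add: algebra_simps flip: of_nat_eq_iff[where 'a=int])
qed

lemma pent_neg_int_Suc: "pent (- int (Suc n)) = Suc n * Suc n + triangle n"
  using two_pent[of "int (Suc n)"] two_pent[of "- int (Suc n)"] pent_int_Suc[of n]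
  by (simp add: algebra_simps flip: of_nat_eq_iff[where 'a=int])

text \<open>Passing from \<open>n\<close> to \<open>Suc n\<close> changes the left side by a
  telescoping sum, whose boundary terms are the two new summands on the right.\<close>

lemma shanks_identity:
  fixes q :: "'a :: comm_ring_1"
  shows "(\<Sum>s\<le>n. (-1)^s * (\<Prod>i=Suc s..n. 1 - q^i) * q^(s * n + triangle s)) =
    (\<Sum>k\<in>{- int n..int n}. (-1)^nat \<bar>k\<bar> * q^pent k)"
proof (induction n)
  case 0
  show ?case by (simp add: pent_def)
next
  case (Suc n)
  define F where "F = (\<lambda>n s. \<Prod>i=Suc s..n. 1 - q^i)"
  define a where "a = (\<lambda>n s. (-1)^s * F n s * q^(s * n + triangle s))"
  \<comment> \<open>The telescoping certificate: \<open>a (Suc n) s - a n s\<close> equals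
    \<open>b (s - 1) - b s\<close> for \<open>0 < s \<le> n\<close>, and \<open>- b 0\<close> for
    \<open>s = 0\<close>.\<close>
  define b where "b = (\<lambda>s. (-1)^s * F n s * q^(Suc s * Suc n + triangle s))"
  have F_Suc: "F (Suc n) s = (1 - q^Suc n) * F n s" if "s \<le> n" for s
    using that by (simp add: F_def mult.commute)
  have F_rec: "F n s = (1 - q^Suc s) * F n (Suc s)" if "s < n" for s
    using that by (simp add: F_def prod.atLeast_Suc_atMost)
  have telescope: "(\<Sum>s\<le>m. a (Suc n) s - a n s) = - b m" if "m \<le> n" for m
    using that
  proof (induction m)
    case 0
    then show ?case
      by (simp add: a_def b_def F_Suc algebra_simps)
  next
    case (Suc m)
    have "a (Suc n) (Suc m) - a n (Suc m) - b m = - b (Suc m)"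
      using Suc.prems by (simp add: a_def b_def F_Suc F_rec[of m] algebra_simps power_add)
    with Suc show ?case
      by (simp add: algebra_simps)
  qed
  \<comment> \<open>The term at \<open>Suc n\<close> has no counterpart in the sum for
    \<open>n\<close>. It supplies the index \<open>k = n + 1\<close>, and \<open>- b n\<close>
    supplies \<open>k = -(n + 1)\<close>.\<close>
  have "(\<Sum>s\<le>Suc n. a (Suc n) s) = (\<Sum>s\<le>n. a n s) - b n + a (Suc n) (Suc n)"
    using telescope[of n] by (simp add: sum_subtractf algebra_simps)
  moreover have "b n = - ((-1)^Suc n * q^pent (- int (Suc n)))"
    unfolding pent_neg_int_Suc by (simp add: b_def F_def)
  moreover have "a (Suc n) (Suc n) = (-1)^Suc n * q^pent (int (Suc n))"
    unfolding pent_int_Suc by (simp add: a_def F_def)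
  moreover have "{- int (Suc n)..int (Suc n)} =
      insert (int (Suc n)) (insert (- int (Suc n)) {- int n..int n})"
    by auto
  ultimately show ?case
    using Suc.IH by (simp add: a_def F_def algebra_simps nat_add_distrib)
qed

section \<open>Two evaluations of a coefficient of the Euler product\<close>

lemma coeff_mult_monom_power_zero:
  fixes p :: "'a :: comm_ring_1 poly"
  assumes "m < k"
  shows "coeff (p * monom 1 1 ^ k) m = 0"
  using assms unfolding mult.commute[of p] by (simp add: monom_power coeff_monom_mult)

text \<open>In Shanks' identity with \<open>n = m\<close>, every term with \<open>s > 0\<close> has
  a factor \<open>q^(s * m + triangle s)\<close> of degree above \<open>m\<close>. Only
  \<open>s = 0\<close>, the Euler product itself, reaches the coefficient at
  \<open>m\<close>.\<close>

lemma coeff_euler_product: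
  "coeff (\<Prod>i=1..m. 1 - monom 1 1 ^ i :: int poly) m = (\<Sum>k | pent k = m. (-1)^nat \<bar>k\<bar>)"
proof -
  let ?q = "monom 1 1 :: int poly"
  let ?t = "\<lambda>s. (-1)^s * (\<Prod>i=Suc s..m. 1 - ?q^i) * ?q^(s * m + triangle s)"
  have "coeff (?t s) m = 0" if "s \<noteq> 0" for s
  proof (rule coeff_mult_monom_power_zero)
    from that obtain r where "s = Suc r"
      by (auto simp: gr0_conv_Suc)
    then show "m < s * m + triangle s"
      by simp
  qed
  then have "(\<Sum>s\<le>m. coeff (?t s) m) = coeff (?t 0) m"
    by (subst sum.remove[of _ 0]) auto
  then have "coeff (\<Prod>i=1..m. 1 - ?q^i) m = coeff (\<Sum>s\<le>m. ?t s) m"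
    by (simp add: coeff_sum)
  also have "\<dots> = (\<Sum>k\<in>{- int m..int m}. coeff ((-1)^nat \<bar>k\<bar> * ?q^pent k) m)"
    by (simp only: shanks_identity coeff_sum)
  also have "\<dots> = (\<Sum>k\<in>{- int m..int m}. if pent k = m then (-1)^nat \<bar>k\<bar> else 0)"
    by (intro sum.cong) (auto simp: monom_power minus_one_power_iff)
  also have "\<dots> = (\<Sum>k | pent k = m. (-1)^nat \<bar>k\<bar>)"
  proof (rule sum.mono_neutral_cong_right)
    show "{k. pent k = m} \<subseteq> {- int m..int m}"
    proof
      fix k assume "k \<in> {k. pent k = m}"
      then have "\<bar>k\<bar> \<le> int m"
        using abs_le_pent by blast
      then show "k \<in> {- int m..int m}"
        unfolding atLeastAtMost_iff by linarith
    qed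
  qed auto
  finally show ?thesis .
qed

definition distinct_partitions :: "nat \<Rightarrow> nat set set" where
  "distinct_partitions m = {T. T \<subseteq> {1..m} \<and> \<Sum>T = m}"

text \<open>Expanding the product picks the term \<open>- q^i\<close> for each \<open>i\<close> in a
  subset \<open>T\<close>, which is then the set of parts.\<close>

lemma coeff_euler_product_distinct:
  "coeff (\<Prod>i=1..m. 1 - monom 1 1 ^ i :: int poly) m = (\<Sum>T\<in>distinct_partitions m. (-1)^card T)"
proof -
  let ?q = "monom 1 1 :: int poly"
  have "(\<Prod>i\<in>T. - (?q^i)) = (-1)^card T * ?q^\<Sum>T" for T :: "nat set"
    by (simp add: prod_uminus power_sum)
  then have "(\<Prod>i=1..m. 1 - ?q^i) = (\<Sum>T\<in>Pow {1..m}. (-1)^card T * ?q^\<Sum>T)"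
    using prod_add[of "{1..m}" "\<lambda>i. - (?q^i)" "\<lambda>_. 1"] by (simp add: add.commute)
  then have "coeff (\<Prod>i=1..m. 1 - ?q^i) m =
      (\<Sum>T\<in>Pow {1..m}. if \<Sum>T = m then (-1)^card T else 0)"
    by (auto simp: coeff_sum monom_power minus_one_power_iff intro!: sum.cong)
  also have "\<dots> = (\<Sum>T\<in>distinct_partitions m. (-1)^card T)"
    by (intro sum.mono_neutral_cong_right) (auto simp: distinct_partitions_def)
  finally show ?thesis .
qed

text \<open>Signs vanish modulo 2. This turns signed counts into parities, both for the Euler
  product and for the toggling.\<close>

lemma odd_sum_minus_one_power:
  "finite A \<Longrightarrow> odd (\<Sum>x\<in>A. (-1)^f x :: int) \<longleftrightarrow> odd (card A)"
  by (induction A rule: finite_induct) auto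

theorem odd_card_distinct_partitions:
  "odd (card (distinct_partitions m)) \<longleftrightarrow> (\<exists>x::int. 24 * int m + 1 = x\<^sup>2)"
proof -
  have "finite (distinct_partitions m)"
    by (rule finite_subset[of _ "Pow {1..m}"]) (auto simp: distinct_partitions_def)
  then have "odd (card (distinct_partitions m)) \<longleftrightarrow> odd (\<Sum>k | pent k = m. (-1)^nat \<bar>k\<bar> :: int)"
    using coeff_euler_product[of m] coeff_euler_product_distinct[of m]
    by (metis odd_sum_minus_one_power)
  also have "\<dots> \<longleftrightarrow> (\<exists>k. pent k = m)"
  proof (cases "\<exists>k. pent k = m")
    case True
    then obtain k where "{k. pent k = m} = {k}"
      using inj_pent by (auto dest: injD)
    with True show ?thesis by simp
  qed simp
  finally show ?thesis
    by (simp only: ex_pent_iff_square)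
qed

section \<open>The toggling involution\<close>

definition regular_overpartitions :: "nat \<Rightarrow> nat \<Rightarrow> (nat multiset \<times> nat set) set" where
  "regular_overpartitions l n =
    {P \<in> overpartitions n. \<forall>p \<in># nonoverlined_parts P. \<not> l dvd p}"

text \<open>All copies of a part except one overlined copy are non-overlined, so a multiple of
  \<open>l\<close> can occur only once, and overlined. An infinite \<open>S\<close>, for which
  \<open>mset_set S\<close> is empty by default, is excluded on both sides.\<close>

lemma mem_regular_overpartitions:
  "(M, S) \<in> regular_overpartitions l n \<longleftrightarrow>
    0 \<notin># M \<and> \<Sum>\<^sub># M = n \<and> S \<subseteq> set_mset M \<and>
    (\<forall>p. l dvd p \<longrightarrow> count M p \<le> (if p \<in> S then 1 else 0))"
proof (cases "finite S")
  case True
  then have "p \<in># M - mset_set S \<longleftrightarrow> \<not> count M p \<le> (if p \<in> S then 1 else 0)" for p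
    by (simp add: in_diff_count count_mset_set' not_le)
  then have "(\<forall>p \<in># M - mset_set S. \<not> l dvd p) \<longleftrightarrow>
      (\<forall>p. l dvd p \<longrightarrow> count M p \<le> (if p \<in> S then 1 else 0))"
    by blast
  then show ?thesis
    by (auto simp: regular_overpartitions_def overpartitions_def nonoverlined_parts_def)
qed (auto simp: regular_overpartitions_def overpartitions_def dest: finite_subset)

text \<open>The size \<open>p\<close> is determined by the multiset alone, which stays unchanged, so
  a second application toggles the same size. The minimum is meaningful only if some part is not
  divisible by \<open>l\<close>.\<close>

definition toggle :: "nat \<Rightarrow> nat multiset \<times> nat set \<Rightarrow> nat multiset \<times> nat set" where
  "toggle l P = (let p = Min {p \<in> set_mset (fst P). \<not> l dvd p} in
    (fst P, if p \<in> snd P then snd P - {p} else insert p (snd P)))"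

lemma even_card_regular_overpartitions:
  "even (card {P \<in> regular_overpartitions l n. \<exists>p \<in># fst P. \<not> l dvd p})" (is "even (card ?A)")
proof -
  have toggle: "(-1)^card (snd (toggle l P)) + (-1)^card (snd P) = (0 :: int)"
    "toggle l P \<in> ?A" "toggle l (toggle l P) = P" "toggle l P \<noteq> P" if P: "P \<in> ?A" for P
  proof -
    obtain M S where MS: "P = (M, S)" by (cases P)
    define p where "p = Min {p \<in> set_mset M. \<not> l dvd p}"
    have M: "(M, S) \<in> regular_overpartitions l n" "\<exists>p \<in># M. \<not> l dvd p"
      using P MS by simp_all
    then have "p \<in> {p \<in> set_mset M. \<not> l dvd p}"
      unfolding p_def by (intro Min_in) auto
    then have p: "p \<in># M" "\<not> l dvd p"
      by blast+
    have eq: "toggle l (M, T) = (M, if p \<in> T then T - {p} else insert p T)" for T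
      by (simp add: toggle_def p_def Let_def)
    have S: "S \<subseteq> set_mset M"
      using M(1) by (simp add: mem_regular_overpartitions)
    then have "finite S"
      by (rule finite_subset) simp
    define S' where "S' = (if p \<in> S then S - {p} else insert p S)"
    have "card S' = Suc (card S) \<or> card S = Suc (card S')"
      using card.remove[OF \<open>finite S\<close>, of p] card_insert_disjoint[OF \<open>finite S\<close>, of p]
      unfolding S'_def by presburger
    then show "(-1)^card (snd (toggle l P)) + (-1)^card (snd P) = (0 :: int)"
      by (auto simp: MS eq simp flip: S'_def)
    have "r \<in> S' \<longleftrightarrow> r \<in> S" if "l dvd r" for r
      using that p(2) by (auto simp: S'_def)
    moreover have "S' \<subseteq> set_mset M"
      using S p(1) by (auto simp: S'_def)
    ultimately have "(M, S') \<in> regular_overpartitions l n"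
      using M(1) by (simp add: mem_regular_overpartitions)
    then show "toggle l P \<in> ?A"
      using M(2) by (simp add: MS eq flip: S'_def)
    show "toggle l (toggle l P) = P" "toggle l P \<noteq> P"
      unfolding MS eq by auto
  qed
  \<comment> \<open>Toggling changes the number of overlined sizes by one, so the signs cancel in
    pairs; a vanishing sum of signs has an even number of terms.\<close>
  have "(\<Sum>P\<in>?A. (-1)^card (snd P) :: int) = 0"
    by (rule sum_involution_eq_0[where h = "toggle l"]) (fact toggle)+
  moreover have "finite ?A"
    using finite_overpartitions[of n] by (simp add: regular_overpartitions_def)
  ultimately show ?thesis
    using odd_sum_minus_one_power[of ?A "\<lambda>P. card (snd P)"] by simp
qed

section \<open>Overpartitions with all parts divisible by \<open>l\<close>\<close>

lemma regular_overpartitions_all_dvd: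
  assumes "l > 0"
  shows "{P \<in> regular_overpartitions l n. \<forall>p \<in># fst P. l dvd p} =
    (\<lambda>S. (mset_set S, S)) ` {S. finite S \<and> 0 \<notin> S \<and> \<Sum>S = n \<and> (\<forall>p\<in>S. l dvd p)}"
    (is "?L = ?R")
proof (intro equalityI subsetI)
  fix P assume P: "P \<in> ?L"
  obtain M S where [simp]: "P = (M, S)" by (cases P)
  have S: "S \<subseteq> set_mset M"
    using P by (simp add: mem_regular_overpartitions)
  then have "finite S"
    by (rule finite_subset) simp
  \<comment> \<open>Every part is a multiple of \<open>l\<close>, hence occurs exactly once and is
    overlined.\<close>
  have "M = mset_set S"
  proof (rule multiset_eqI)
    fix p
    show "count M p = count (mset_set S) p"
    proof (cases "p \<in># M")
      case True
      then have "count M p \<le> (if p \<in> S then 1 else 0)" "0 < count M p"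
        using P by (simp_all add: mem_regular_overpartitions)
      then have "count M p = (if p \<in> S then 1 else 0)"
        by (simp split: if_splits del: count_greater_zero_iff)
      then show ?thesis
        using \<open>finite S\<close> by (simp add: count_mset_set')
    next
      case False
      moreover from this have "p \<notin> S"
        using S by blast
      ultimately show ?thesis
        by (simp add: count_mset_set' not_in_iff)
    qed
  qed
  then show "P \<in> ?R"
    using P S \<open>finite S\<close> by (auto simp: mem_regular_overpartitions sum_unfold_sum_mset)
qed (auto simp: mem_regular_overpartitions sum_unfold_sum_mset count_mset_set')

text \<open>Dividing every part by \<open>l\<close> is inverse to scaling by \<open>l\<close>, and a
  sum of multiples of \<open>l\<close> forces \<open>l dvd n\<close>.\<close>

lemma distinct_partitions_scale:
  assumes "l > 0"
  shows "{S. finite S \<and> 0 \<notin> S \<and> \<Sum>S = n \<and> (\<forall>p\<in>S. l dvd p)} =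
    (if l dvd n then (`) ((*) l) ` distinct_partitions (n div l) else {})" (is "?L = ?R")
proof (intro equalityI subsetI)
  fix S assume S: "S \<in> ?L"
  define T where "T = (\<lambda>p. p div l) ` S"
  have S_eq: "S = (*) l ` T"
    using S by (force simp: T_def image_image)
  moreover have "inj_on ((*) l) T"
    using assms by (auto intro: inj_onI)
  ultimately have n: "n = l * \<Sum>T"
    using S by (simp add: sum.reindex sum_distrib_left)
  have "finite T" "0 \<notin> T"
    using S assms by (auto simp: T_def dvd_div_eq_0_iff)
  \<comment> \<open>A single part is at most the sum of all parts, which yields the upper bound
    built into \<open>distinct_partitions\<close>.\<close>
  then have "T \<subseteq> {1..\<Sum>T}"
    using member_le_sum[of _ T "\<lambda>x. x"] by (auto simp: Suc_le_eq intro: gr0I)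
  then have "T \<in> distinct_partitions (n div l)"
    using n assms by (simp add: distinct_partitions_def)
  then show "S \<in> ?R"
    using S_eq n by auto
next
  fix S assume "S \<in> ?R"
  then obtain T where T: "l dvd n" "S = (*) l ` T" "T \<subseteq> {1..n div l}" "\<Sum>T = n div l"
    by (auto simp: distinct_partitions_def split: if_splits)
  moreover have "inj_on ((*) l) T"
    using assms by (auto intro: inj_onI)
  moreover have "finite T"
    using T(3) finite_subset by blast
  ultimately show "S \<in> ?L"
    using assms by (auto simp: sum.reindex simp flip: sum_distrib_left)
qed

lemma odd_Rbar_star_iff:
  assumes "l > 0"
  shows "odd (Rbar_star l n) \<longleftrightarrow> l dvd n \<and> odd (card (distinct_partitions (n div l)))"
proof -
  let ?A = "{P \<in> regular_overpartitions l n. \<exists>p \<in># fst P. \<not> l dvd p}"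
  let ?B = "{P \<in> regular_overpartitions l n. \<forall>p \<in># fst P. l dvd p}"
  have "finite (regular_overpartitions l n)"
    using finite_overpartitions[of n] by (simp add: regular_overpartitions_def)
  then have "card (?A \<union> ?B) = card ?A + card ?B"
    by (intro card_Un_disjoint) auto
  moreover have "?A \<union> ?B = regular_overpartitions l n"
    by auto
  ultimately have "odd (Rbar_star l n) \<longleftrightarrow> odd (card ?B)"
    using even_card_regular_overpartitions[of l n]
    by (simp add: Rbar_star_def flip: regular_overpartitions_def)
  moreover have "card ?B = (if l dvd n then card (distinct_partitions (n div l)) else 0)"
  proof -
    have "inj_on ((`) ((*) l)) X" for X :: "nat set set"
      using assms by (intro inj_on_image inj_onI) auto
    then show ?thesis
      unfolding regular_overpartitions_all_dvd[OF assms] distinct_partitions_scale[OF assms]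
      by (auto simp: card_image inj_on_def[of "\<lambda>S. (mset_set S, S)"])
  qed
  ultimately show ?thesis by auto
qed

theorem theorem1p5:
  fixes l n :: nat
  assumes "l \<ge> 2"
  shows "odd (Rbar_star l n) \<longleftrightarrow>
    l dvd n \<and> (\<exists>m::int. 24 * real n / real l + 1 = (real_of_int m)\<^sup>2)"
proof (cases "l dvd n")
  case True
  then obtain k where n: "n = l * k" ..
  \<comment> \<open>With \<open>n = l * k\<close> the factor \<open>l\<close> cancels, so both sides
    of the real equation are images of integers.\<close>
  have "24 * real n / real l + 1 = (real_of_int m)\<^sup>2 \<longleftrightarrow> 24 * int k + 1 = m\<^sup>2" for m
  proof -
    have "24 * real n / real l + 1 = real_of_int (24 * int k + 1)"
      using n assms by simp
    then show ?thesis
      by (simp only: of_int_power[symmetric] of_int_eq_iff)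
  qed
  then show ?thesis
    using True n assms odd_Rbar_star_iff[of l n] odd_card_distinct_partitions[of k] by simp
qed (use assms odd_Rbar_star_iff[of l n] in simp)

end
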